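(* Let $G$ be a 4-regular (quartic) graph of order $p$, where $5\le p\le 8$. Then $\chi_{la}(G)=\chi(G)$, except that $\chi_{la}(K_{4,4})=\chi(K_{4,4})+1$.
   Context: $\chi(G)$ is the chromatic number. For a simple graph $G=(V,E)$ with $q$ edges, a bijection $f:E\to\{1,\dots,q\}$ is a local antimagic labeling if $f^+(u)\neq f^+(v)$ for every edge $uv$, where $f^+(u)=\sum_{e\ni u} f(e)$. The local antimagic chromatic number $\chi_{la}(G)$ is the minimum number of distinct values of $f^+$ over all local antimagic labelings $f$ of $G$. *)

theory Defs
  imports Main
begin

definition simple_graph :: "'a set \<Rightarrow> 'a set set \<Rightarrow> bool" where
  "simple_graph V E \<longleftrightarrow> finite V \<and> (\<forall>e\<in>E. e \<subseteq> V \<and> card e = 2)"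

definition incident_edges :: "'a set set \<Rightarrow> 'a \<Rightarrow> 'a set set" where
  "incident_edges E v = {e \<in> E. v \<in> e}"

definition regular_graph :: "nat \<Rightarrow> 'a set \<Rightarrow> 'a set set \<Rightarrow> bool" where
  "regular_graph k V E \<longleftrightarrow> simple_graph V E \<and> (\<forall>v\<in>V. card (incident_edges E v) = k)"

definition proper_colouring :: "'a set set \<Rightarrow> ('a \<Rightarrow> nat) \<Rightarrow> bool" where
  "proper_colouring E c \<longleftrightarrow> (\<forall>u v. {u, v} \<in> E \<longrightarrow> c u \<noteq> c v)"

definition chromatic_number :: "'a set \<Rightarrow> 'a set set \<Rightarrow> nat" where
  "chromatic_number V E = Inf {card (c ` V) | c. proper_colouring E c}"

definition vertex_sum :: "'a set set \<Rightarrow> ('a set \<Rightarrow> nat) \<Rightarrow> 'a \<Rightarrow> nat" where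
  "vertex_sum E f v = (\<Sum>e\<in>incident_edges E v. f e)"

definition local_antimagic_labeling :: "'a set set \<Rightarrow> ('a set \<Rightarrow> nat) \<Rightarrow> bool" where
  "local_antimagic_labeling E f \<longleftrightarrow>
     bij_betw f E {1..card E} \<and>
     (\<forall>u v. {u, v} \<in> E \<longrightarrow> vertex_sum E f u \<noteq> vertex_sum E f v)"

text \<open>
  The infimum of the empty set of naturals is \<open>0\<close>, so a graph without any
  local antimagic labeling would get the value \<open>0\<close>. A positive value is always attained by
  some labeling.
\<close>

definition local_antimagic_chromatic_number :: "'a set \<Rightarrow> 'a set set \<Rightarrow> nat" where
  "local_antimagic_chromatic_number V E =
     Inf {card (vertex_sum E f ` V) | f. local_antimagic_labeling E f}"

definition graph_isomorphic ::
    "'a set \<Rightarrow> 'a set set \<Rightarrow> 'b set \<Rightarrow> 'b set set \<Rightarrow> bool" where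
  "graph_isomorphic V E V' E' \<longleftrightarrow>
     (\<exists>\<phi>. bij_betw \<phi> V V' \<and> (\<forall>u\<in>V. \<forall>v\<in>V. {u, v} \<in> E \<longleftrightarrow> {\<phi> u, \<phi> v} \<in> E'))"

definition complete_bipartite_verts :: "nat \<Rightarrow> nat \<Rightarrow> (nat + nat) set" where
  "complete_bipartite_verts m n = {..<m} <+> {..<n}"

definition complete_bipartite_edges :: "nat \<Rightarrow> nat \<Rightarrow> (nat + nat) set set" where
  "complete_bipartite_edges m n = {{Inl i, Inr j} | i j. i < m \<and> j < n}"

end

theory Submission
  imports Defs
begin

text \<open>
  The sums \<open>f\<^sup>+\<close> of a local antimagic labeling form a proper colouring, so it is enough to exhibit
  a labeling with \<open>\<chi>\<close> distinct sums. The complement of a quartic graph of order \<open>p\<close> is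
  \<open>(p - 5)\<close>-regular, and numbering its vertices in breadth-first order leaves only 56 possible
  adjacency structures for \<open>5 \<le> p \<le> 8\<close>. Each of them but \<open>K\<^sub>4\<^sub>,\<^sub>4\<close> comes with an explicit labeling
  with, say, \<open>k\<close> distinct sums, and an exhaustive search shows that \<open>k - 1\<close> colours do not suffice.
  For \<open>K\<^sub>4\<^sub>,\<^sub>4\<close>, two sums are excluded by double counting the labels.
\<close>

section \<open>Breadth-first codes of regular graphs\<close>

text \<open>
  The \<open>i\<close>-th row of a code lists the neighbours \<open>j > i\<close> of vertex \<open>i\<close>. In a state \<open>(m, rows)\<close> the
  vertices \<open>j < m\<close> have been reached from the rows fixed so far. The new neighbours of the next vertex
  may be assumed to carry the smallest unused numbers, because no condition has yet distinguished
  the unreached vertices.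
\<close>

definition extend :: "nat \<Rightarrow> nat \<Rightarrow> nat \<times> nat list list \<Rightarrow> (nat \<times> nat list list) list" where
  "extend n d = (\<lambda>(m, rows).
     let i = length rows; m' = max m (Suc i); b = length (filter (\<lambda>r. i \<in> set r) rows) in
     map (\<lambda>s. let k = d - b - length s in (m' + k, rows @ [s @ [m'..<m' + k]]))
       (filter (\<lambda>s. b + length s \<le> d \<and> m' + (d - b - length s) \<le> n) (subseqs [Suc i..<m'])))"

fun states :: "nat \<Rightarrow> nat \<Rightarrow> nat \<Rightarrow> (nat \<times> nat list list) list" where
  "states n d 0 = [(0, [])]"
| "states n d (Suc i) = concat (map (extend n d) (states n d i))"

text \<open>Codes are not canonical: the 51 codes for order 8 and degree 3 describe just the six
  cubic graphs on eight vertices up to isomorphism.\<close>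

definition codes :: "nat \<Rightarrow> nat \<Rightarrow> nat list list list" where
  "codes n d = map snd (states n d n)"

text \<open>The invariant of the search. No fixed row has an entry from \<open>m\<close> on, so the
  numbers from \<open>m\<close> on that have no row yet may still be permuted without changing any
  fixed row.\<close>

definition numbering ::
  "'a set \<Rightarrow> ('a \<Rightarrow> 'a \<Rightarrow> bool) \<Rightarrow> nat \<times> nat list list \<Rightarrow> (nat \<Rightarrow> 'a) \<Rightarrow> bool" where
  "numbering V R = (\<lambda>(m, rows) \<phi>.
     bij_betw \<phi> {..<card V} V \<and> m \<le> card V \<and> (\<forall>r\<in>set rows. set r \<subseteq> {..<m}) \<and>
     (\<forall>i j. i < length rows \<longrightarrow> i < j \<longrightarrow> j < card V \<longrightarrow>
        R (\<phi> i) (\<phi> j) = (j \<in> set (rows ! i))))"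

lemma length_states: "(m, rows) \<in> set (states n d i) \<Longrightarrow> length rows = i"
  by (induction i arbitrary: m rows) (auto simp: extend_def Let_def)

lemma ex_bij_betw_initial_segment:
  fixes a n :: nat
  assumes "T \<subseteq> {a..<n}"
  shows "\<exists>\<pi>. bij_betw \<pi> {a..<n} {a..<n} \<and> (\<forall>j\<in>{a..<n}. \<pi> j \<in> T \<longleftrightarrow> j < a + card T)"
proof -
  let ?I = "{a..<a + card T}" and ?J = "{a + card T..<n}" and ?C = "{a..<n} - T"
  have finT: "finite T" using assms finite_subset by blast
  have cT: "card T \<le> n - a" using card_mono[OF _ assms] by simp
  have cC: "card ?C = n - a - card T" using assms finT by (simp add: card_Diff_subset)
  obtain g where g: "bij_betw g ?I T"
    using finite_same_card_bij[of ?I T] finT by auto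
  obtain h where h: "bij_betw h ?J ?C"
    using finite_same_card_bij[of ?J ?C] cC by auto
  define \<pi> where "\<pi> = (\<lambda>j. if j \<in> ?I then g j else h j)"
  have "bij_betw \<pi> (?I \<union> ?J) (T \<union> ?C)"
    unfolding \<pi>_def using g h by (intro bij_betw_disjoint_Un) auto
  moreover have "?I \<union> ?J = {a..<n}"
    using cT by (cases "card T = 0") auto
  moreover have "T \<union> ?C = {a..<n}" using assms by auto
  moreover have "\<pi> j \<in> T \<longleftrightarrow> j < a + card T" if "j \<in> {a..<n}" for j
    using that bij_betw_apply[OF g, of j] bij_betw_apply[OF h, of j] by (auto simp: \<pi>_def)
  ultimately show ?thesis by auto
qed

lemma numbering_extend:
  fixes V :: "'a set" and R :: "'a \<Rightarrow> 'a \<Rightarrow> bool"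
  assumes fin: "finite V"
    and sym: "\<And>u v. R u v \<Longrightarrow> R v u" and irr: "\<And>v. \<not> R v v"
    and reg: "\<And>v. v \<in> V \<Longrightarrow> card {w \<in> V. R v w} = d"
    and num: "numbering V R (m, rows) \<phi>" and less: "length rows < card V"
  shows "\<exists>st \<in> set (extend (card V) d (m, rows)). \<exists>\<phi>'. numbering V R st \<phi>'"
proof -
  \<comment> \<open>If \<open>m \<le> i\<close>, no earlier row contains \<open>i\<close>: a new
    component starts there, and \<open>m'\<close> counts \<open>i\<close> itself as reached.\<close>
  define n i m' b where "n = card V" and "i = length rows" and "m' = max m (Suc i)"
    and "b = length (filter (\<lambda>r. i \<in> set r) rows)"
  have bij: "bij_betw \<phi> {..<n} V" and mn: "m \<le> n"
    and rm: "\<And>r. r \<in> set rows \<Longrightarrow> set r \<subseteq> {..<m}"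
    and adj: "\<And>i' j. i' < i \<Longrightarrow> i' < j \<Longrightarrow> j < n \<Longrightarrow> R (\<phi> i') (\<phi> j) = (j \<in> set (rows ! i'))"
    using num by (auto simp: numbering_def n_def i_def)
  have i_n: "i < n" and m'_n: "m' \<le> n" using less mn by (auto simp: n_def i_def m'_def)
  define N where "N = {j. j < n \<and> R (\<phi> i) (\<phi> j)}"
  define B where "B = {j \<in> N. j < i}"
  define S where "S = {j \<in> N. i < j \<and> j < m'}"
  define T where "T = {j \<in> N. m' \<le> j}"
  have finN: "finite N" by (simp add: N_def)
  have "bij_betw \<phi> N {w \<in> V. R (\<phi> i) w}"
    using bij by (auto simp: bij_betw_def N_def inj_on_def)
  then have "card N = d"
    using reg[of "\<phi> i"] bij_betw_apply[OF bij, of i] i_n by (simp add: bij_betw_same_card)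
  moreover have "card N = card B + card S + card T"
  proof -
    have "i \<notin> N" using irr by (simp add: N_def)
    then have "N = (B \<union> S) \<union> T"
      by (auto simp: B_def S_def T_def m'_def intro: ccontr)
    moreover have "card ((B \<union> S) \<union> T) = card (B \<union> S) + card T"
      using finN by (intro card_Un_disjoint) (auto simp: B_def S_def T_def m'_def)
    moreover have "card (B \<union> S) = card B + card S"
      using finN by (intro card_Un_disjoint) (auto simp: B_def S_def)
    ultimately show ?thesis by simp
  qed
  moreover have "card B = b"
  proof -
    have "B = {j. j < length rows \<and> i \<in> set (rows ! j)}"
      using adj[of _ i] sym i_n by (auto simp: B_def N_def i_def)
    then show ?thesis by (simp add: b_def length_filter_conv_card)
  qed
  moreover obtain s where s: "s \<in> set (subseqs [Suc i..<m'])" "set s = S"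
  proof -
    have "S \<in> Pow (set [Suc i..<m'])" by (auto simp: S_def)
    then show ?thesis using that by (metis imageE subseqs_powset)
  qed
  moreover have "card S = length s"
    using s subseqs_distinctD[OF s(1)] by (metis distinct_card distinct_upt)
  ultimately have d: "d = b + length s + card T" by simp
  have T: "T \<subseteq> {m'..<n}" by (auto simp: T_def N_def)
  have "card T \<le> n - m'" using card_mono[OF _ T] by simp
  then have mT: "m' + card T \<le> n" using m'_n by simp
  define st where "st = (m' + card T, rows @ [s @ [m'..<m' + card T]])"
  have st: "st \<in> set (extend n d (m, rows))"
    using s(1) d mT
    by (auto simp: extend_def Let_def st_def simp flip: i_def m'_def b_def intro!: image_eqI[of _ _ s])
  obtain \<pi> where \<pi>: "bij_betw \<pi> {m'..<n} {m'..<n}"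
    and \<pi>T: "\<And>j. m' \<le> j \<Longrightarrow> j < n \<Longrightarrow> \<pi> j \<in> T \<longleftrightarrow> j < m' + card T"
    using ex_bij_betw_initial_segment[OF T] by auto
  \<comment> \<open>Numbers below \<open>m'\<close> stay put, which preserves the vertex
    \<open>i\<close> and all entries of fixed rows; only unreached numbers move.\<close>
  define \<sigma> where "\<sigma> = (\<lambda>j. if j \<in> {..<m'} then j else \<pi> j)"
  have "bij_betw \<sigma> ({..<m'} \<union> {m'..<n}) ({..<m'} \<union> {m'..<n})"
    unfolding \<sigma>_def using \<pi> bij_betw_id[of "{..<m'}"]
    by (intro bij_betw_disjoint_Un) (auto simp: id_def)
  moreover have "{..<m'} \<union> {m'..<n} = {..<n}" using m'_n by auto
  ultimately have \<sigma>: "bij_betw \<sigma> {..<n} {..<n}" by simp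
  have lo: "\<sigma> j = j" if "j < m'" for j using that by (simp add: \<sigma>_def)
  have hi: "\<sigma> j = \<pi> j" "m' \<le> \<pi> j" "\<pi> j < n" if "m' \<le> j" "j < n" for j
    using that bij_betw_apply[OF \<pi>, of j] by (auto simp: \<sigma>_def)
  have "numbering V R st (\<phi> \<circ> \<sigma>)"
  proof -
    have "bij_betw (\<phi> \<circ> \<sigma>) {..<n} V" using bij_betw_trans[OF \<sigma> bij] .
    moreover have "set r \<subseteq> {..<m' + card T}" if "r \<in> set (snd st)" for r
    proof -
      have "{..<m} \<subseteq> {..<m' + card T}" and "S \<subseteq> {..<m' + card T}"
        by (auto simp: m'_def S_def)
      then show ?thesis using that rm s(2) by (fastforce simp: st_def)
    qed
    moreover have "R (\<phi> (\<sigma> i')) (\<phi> (\<sigma> j)) = (j \<in> set ((rows @ [s @ [m'..<m' + card T]]) ! i'))"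
      if "i' < Suc i" "i' < j" "j < n" for i' j
    proof (cases "i' = i")
      case True
      have row: "(rows @ [s @ [m'..<m' + card T]]) ! i' = s @ [m'..<m' + card T]"
        using True by (simp add: i_def)
      have "\<sigma> i' = i" using lo True by (simp add: m'_def)
      moreover have "R (\<phi> i) (\<phi> (\<sigma> j)) = (j \<in> S \<or> m' \<le> j \<and> j < m' + card T)"
      proof (cases "j < m'")
        case j: True
        then show ?thesis using that True lo[of j] by (auto simp: S_def N_def)
      next
        case False
        then have "m' \<le> j" by simp
        then show ?thesis using \<pi>T[of j] hi[of j] that False by (auto simp: T_def N_def S_def)
      qed
      ultimately show ?thesis using row s(2) by auto
    next
      case False
      then have i': "i' < i" using that by simp
      then have "\<sigma> i' = i'" using lo by (simp add: m'_def)
      moreover have "R (\<phi> i') (\<phi> (\<sigma> j)) = (j \<in> set (rows ! i'))"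
      proof (cases "j < m'")
        case True
        then show ?thesis using lo adj i' that by simp
      next
        case False
        then have j: "m' \<le> j" by simp
        \<comment> \<open>Both \<open>j\<close> and \<open>\<pi> j\<close> lie beyond every entry of
          an earlier row, so the permutation cannot change adjacency to
          \<open>\<phi> i'\<close>.\<close>
        have "k \<notin> set (rows ! i')" if "m' \<le> k" for k
          using rm[of "rows ! i'"] i' that by (auto simp: i_def m'_def)
        then show ?thesis
          using adj[of i' "\<pi> j"] i' that hi[OF j] j by (simp add: m'_def)
      qed
      ultimately show ?thesis using i' by (simp add: nth_append i_def)
    qed
    ultimately show ?thesis
      using mT by (simp add: numbering_def st_def n_def i_def)
  qed
  then show ?thesis using st unfolding n_def by blast
qed

text \<open>Starting from any enumeration of \<open>V\<close>, \<open>card V\<close> extension steps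
  leave no pair \<open>i < j\<close> undecided, so the final rows describe \<open>R\<close> on
  \<open>V\<close> completely.\<close>

lemma ex_code:
  fixes V :: "'a set" and R :: "'a \<Rightarrow> 'a \<Rightarrow> bool"
  assumes "finite V"
    and "\<And>u v. R u v \<Longrightarrow> R v u" and "\<And>v. \<not> R v v"
    and "\<And>v. v \<in> V \<Longrightarrow> card {w \<in> V. R v w} = d"
  obtains rows \<phi> where "rows \<in> set (codes (card V) d)" and "bij_betw \<phi> {..<card V} V"
    and "\<forall>i j. i < j \<longrightarrow> j < card V \<longrightarrow> R (\<phi> i) (\<phi> j) = (j \<in> set (rows ! i))"
proof -
  have "\<exists>st \<in> set (states (card V) d i). \<exists>\<phi>. numbering V R st \<phi>" if "i \<le> card V" for i
    using that
  proof (induction i)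
    case 0
    then show ?case
      using ex_bij_betw_nat_finite[OF assms(1)] by (simp add: numbering_def atLeast0LessThan)
  next
    case (Suc i)
    then obtain m rows \<phi> where st: "(m, rows) \<in> set (states (card V) d i)"
      and "numbering V R (m, rows) \<phi>"
      by fastforce
    moreover have "length rows < card V" using length_states[OF st] Suc.prems by simp
    ultimately have "\<exists>st \<in> set (extend (card V) d (m, rows)). \<exists>\<phi>'. numbering V R st \<phi>'"
      using assms by (intro numbering_extend) auto
    then show ?case using st by auto
  qed
  then obtain m rows \<phi> where st: "(m, rows) \<in> set (states (card V) d (card V))"
    and num: "numbering V R (m, rows) \<phi>"
    by fastforce
  show ?thesis
  proof
    show "rows \<in> set (codes (card V) d)" using st by (force simp: codes_def)
    show "bij_betw \<phi> {..<card V} V" using num by (simp add: numbering_def)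
    show "\<forall>i j. i < j \<longrightarrow> j < card V \<longrightarrow> R (\<phi> i) (\<phi> j) = (j \<in> set (rows ! i))"
      using num length_states[OF st] by (simp add: numbering_def)
  qed
qed

section \<open>Isomorphism invariance and elementary bounds\<close>

lemma simple_graph_edge:
  assumes "simple_graph V E" and "{u, v} \<in> E"
  shows "u \<in> V" "v \<in> V" "u \<noteq> v"
  using assms by (auto simp: simple_graph_def)

lemma graph_isomorphic_sym:
  assumes "graph_isomorphic V E V' E'"
  shows "graph_isomorphic V' E' V E"
proof -
  obtain \<phi> where \<phi>: "bij_betw \<phi> V V'" "\<forall>u\<in>V. \<forall>v\<in>V. {u, v} \<in> E \<longleftrightarrow> {\<phi> u, \<phi> v} \<in> E'"
    using assms by (auto simp: graph_isomorphic_def)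
  have inv: "inv_into V \<phi> u \<in> V" "\<phi> (inv_into V \<phi> u) = u" if "u \<in> V'" for u
    using \<phi>(1) that by (auto simp: bij_betw_def inv_into_into f_inv_into_f)
  show ?thesis
    unfolding graph_isomorphic_def
    by (rule exI[of _ "inv_into V \<phi>"]) (simp add: bij_betw_inv_into[OF \<phi>(1)] \<phi>(2) inv)
qed

text \<open>Colourings pull back along \<open>\<phi>\<close>. With the symmetry of isomorphism this
  makes the two sets of counts equal, hence their infima too.\<close>

lemma colour_counts_subset:
  assumes "simple_graph V E" and "graph_isomorphic V E V' E'"
  shows "{card (c ` V') | c. proper_colouring E' c} \<subseteq> {card (c ` V) | c. proper_colouring E c}"
proof -
  obtain \<phi> where \<phi>: "bij_betw \<phi> V V'" "\<forall>u\<in>V. \<forall>v\<in>V. {u, v} \<in> E \<longleftrightarrow> {\<phi> u, \<phi> v} \<in> E'"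
    using assms(2) by (auto simp: graph_isomorphic_def)
  have "card (c ` V') = card ((c \<circ> \<phi>) ` V) \<and> proper_colouring E (c \<circ> \<phi>)"
    if "proper_colouring E' c" for c
  proof
    show "card (c ` V') = card ((c \<circ> \<phi>) ` V)"
      using bij_betw_imp_surj_on[OF \<phi>(1)] by (metis image_comp)
    show "proper_colouring E (c \<circ> \<phi>)"
      using that \<phi>(2) simple_graph_edge[OF assms(1)] unfolding proper_colouring_def comp_def by blast
  qed
  then show ?thesis by blast
qed

lemma chromatic_number_isomorphic:
  assumes "simple_graph V E" "simple_graph V' E'" "graph_isomorphic V E V' E'"
  shows "chromatic_number V E = chromatic_number V' E'"
  unfolding chromatic_number_def
  using colour_counts_subset[OF assms(2) graph_isomorphic_sym[OF assms(3)]]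
    colour_counts_subset[OF assms(1,3)]
  by (rule arg_cong[OF subset_antisym])

text \<open>A labeling of \<open>E'\<close> pulls back along the edge bijection
  \<open>image \<phi>\<close>, which carries the edges at \<open>u\<close> to those at
  \<open>\<phi> u\<close> and so preserves sums. Comparing sets of counts also covers graphs without
  labelings, whose infimum is the default 0.\<close>

lemma antimagic_counts_subset:
  assumes V: "simple_graph V E" and V': "simple_graph V' E'" and "graph_isomorphic V E V' E'"
  shows "{card (vertex_sum E' f ` V') | f. local_antimagic_labeling E' f}
    \<subseteq> {card (vertex_sum E f ` V) | f. local_antimagic_labeling E f}"
proof -
  obtain \<phi> where \<phi>: "bij_betw \<phi> V V'" "\<And>u v. u \<in> V \<Longrightarrow> v \<in> V \<Longrightarrow> {u, v} \<in> E \<longleftrightarrow> {\<phi> u, \<phi> v} \<in> E'"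
    using assms(3) by (auto simp: graph_isomorphic_def)
  have inj: "inj_on \<phi> V" and surj: "\<phi> ` V = V'" using \<phi>(1) by (auto simp: bij_betw_def)
  have E_Pow: "E \<subseteq> Pow V" using V by (auto simp: simple_graph_def)
  have E_img: "image \<phi> ` E = E'"
  proof
    show "image \<phi> ` E \<subseteq> E'"
    proof (clarify)
      fix e assume e: "e \<in> E"
      then obtain u v where uv: "e = {u, v}" using V by (auto simp: simple_graph_def card_2_iff)
      then have "u \<in> V" "v \<in> V" using simple_graph_edge[OF V] e by auto
      then show "\<phi> ` e \<in> E'" using \<phi>(2) uv e by simp
    qed
    show "E' \<subseteq> image \<phi> ` E"
    proof
      fix e assume e: "e \<in> E'"
      then obtain u' v' where uv: "e = {u', v'}" using V' by (auto simp: simple_graph_def card_2_iff)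
      then have "u' \<in> V'" "v' \<in> V'" using simple_graph_edge[OF V'] e by auto
      then obtain u v where "u \<in> V" "v \<in> V" "u' = \<phi> u" "v' = \<phi> v" using surj by auto
      then show "e \<in> image \<phi> ` E" using \<phi>(2)[of u v] uv e by (intro image_eqI[of _ _ "{u, v}"]) auto
    qed
  qed
  have bijE: "bij_betw (image \<phi>) E E'"
    using inj_on_subset[OF inj_on_image_Pow[OF inj] E_Pow] E_img by (simp add: bij_betw_def)
  have inc: "bij_betw (image \<phi>) (incident_edges E u) (incident_edges E' (\<phi> u))" if u: "u \<in> V" for u
  proof -
    have "\<phi> u \<in> \<phi> ` e \<longleftrightarrow> u \<in> e" if "e \<in> E" for e
      using inj_on_image_mem_iff[OF inj u] E_Pow that by blast
    then have "image \<phi> ` incident_edges E u = incident_edges E' (\<phi> u)"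
      unfolding incident_edges_def E_img[symmetric] by blast
    moreover have "incident_edges E u \<subseteq> E" by (auto simp: incident_edges_def)
    ultimately show ?thesis using bij_betw_subset[OF bijE] by metis
  qed
  have "card (vertex_sum E' f ` V') = card (vertex_sum E (f \<circ> image \<phi>) ` V) \<and>
      local_antimagic_labeling E (f \<circ> image \<phi>)"
    if f: "local_antimagic_labeling E' f" for f
  proof -
    have sum: "vertex_sum E (f \<circ> image \<phi>) u = vertex_sum E' f (\<phi> u)" if "u \<in> V" for u
      unfolding vertex_sum_def using sum.reindex_bij_betw[OF inc[OF that], of f] by simp
    then have "vertex_sum E (f \<circ> image \<phi>) ` V = vertex_sum E' f ` V'"
      unfolding surj[symmetric] image_image by (intro image_cong) auto
    moreover have "bij_betw f E' {1..card E}"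
      using f bij_betw_same_card[OF bijE] by (simp add: local_antimagic_labeling_def)
    from bij_betw_trans[OF bijE this] have "bij_betw (f \<circ> image \<phi>) E {1..card E}" .
    moreover have "vertex_sum E (f \<circ> image \<phi>) u \<noteq> vertex_sum E (f \<circ> image \<phi>) v"
      if "{u, v} \<in> E" for u v
      using simple_graph_edge[OF V that] f \<phi>(2) that sum
      by (simp add: local_antimagic_labeling_def)
    ultimately show ?thesis by (simp add: local_antimagic_labeling_def)
  qed
  then show ?thesis by blast
qed

lemma local_antimagic_chromatic_number_isomorphic:
  assumes "simple_graph V E" "simple_graph V' E'" "graph_isomorphic V E V' E'"
  shows "local_antimagic_chromatic_number V E = local_antimagic_chromatic_number V' E'"
  unfolding local_antimagic_chromatic_number_def
  using antimagic_counts_subset[OF assms(2,1) graph_isomorphic_sym[OF assms(3)]]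
    antimagic_counts_subset[OF assms]
  by (rule arg_cong[OF subset_antisym])

section \<open>Bounds and attainment for the two minima\<close>

lemma chromatic_number_le:
  assumes "proper_colouring E c"
  shows "chromatic_number V E \<le> card (c ` V)"
  unfolding chromatic_number_def using assms by (intro cInf_lower) auto

lemma local_antimagic_chromatic_number_le:
  assumes "local_antimagic_labeling E f"
  shows "local_antimagic_chromatic_number V E \<le> card (vertex_sum E f ` V)"
  unfolding local_antimagic_chromatic_number_def using assms by (intro cInf_lower) auto

text \<open>An infimum of naturals is attained once the set is nonempty; an injective colouring is
  proper because edges join distinct vertices.\<close>

lemma chromatic_number_attained:
  assumes "simple_graph V E"
  obtains c where "proper_colouring E c" "chromatic_number V E = card (c ` V)"
proof -
  obtain c :: "'a \<Rightarrow> nat" where "inj_on c V"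
    using assms finite_imp_inj_to_nat_seg[of V] by (auto simp: simple_graph_def)
  then have "proper_colouring E c"
    using simple_graph_edge[OF assms] by (meson proper_colouring_def inj_onD)
  then have "chromatic_number V E \<in> {card (c ` V) | c. proper_colouring E c}"
    unfolding chromatic_number_def by (intro Inf_nat_def1) blast
  then show ?thesis using that by blast
qed

lemma local_antimagic_chromatic_number_attained:
  assumes "local_antimagic_labeling E f"
  obtains g where "local_antimagic_labeling E g"
    "local_antimagic_chromatic_number V E = card (vertex_sum E g ` V)"
proof -
  have "local_antimagic_chromatic_number V E \<in>
      {card (vertex_sum E f ` V) | f. local_antimagic_labeling E f}"
    unfolding local_antimagic_chromatic_number_def using assms by (intro Inf_nat_def1) blast
  then show ?thesis using that by blast
qed

text \<open>The assumed labeling rules out the default value 0 on the right; the sums of a labeling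
  that attains the minimum are then a proper colouring.\<close>

lemma chromatic_number_le_local_antimagic:
  assumes "local_antimagic_labeling E f"
  shows "chromatic_number V E \<le> local_antimagic_chromatic_number V E"
proof -
  obtain g where g: "local_antimagic_labeling E g"
    "local_antimagic_chromatic_number V E = card (vertex_sum E g ` V)"
    using local_antimagic_chromatic_number_attained[OF assms] by blast
  then have "proper_colouring E (vertex_sum E g)"
    by (auto simp: local_antimagic_labeling_def proper_colouring_def)
  then show ?thesis using chromatic_number_le g(2) by metis
qed

section \<open>Checking labelings given as lists\<close>

definition list_graph :: "(nat \<times> nat) list \<Rightarrow> nat set set" where
  "list_graph es = (\<lambda>(i, j). {i, j}) ` set es"

text \<open>Writing each edge with its smaller end first makes the passage to unordered edges
  injective, so positions in \<open>es\<close> index the edges.\<close>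

definition edge_list :: "nat \<Rightarrow> (nat \<times> nat) list \<Rightarrow> bool" where
  "edge_list n es \<longleftrightarrow> distinct es \<and> (\<forall>(i, j) \<in> set es. i < j \<and> j < n)"

definition label_sum :: "(nat \<times> nat) list \<Rightarrow> nat list \<Rightarrow> nat \<Rightarrow> nat" where
  "label_sum es L v = sum_list (map snd (filter (\<lambda>((i, j), l). v = i \<or> v = j) (zip es L)))"

definition antimagic_list :: "(nat \<times> nat) list \<Rightarrow> nat list \<Rightarrow> bool" where
  "antimagic_list es L \<longleftrightarrow> length L = length es \<and> distinct L \<and>
     list_all (\<lambda>l. 1 \<le> l \<and> l \<le> length es) L \<and>
     list_all (\<lambda>(i, j). label_sum es L i \<noteq> label_sum es L j) es"

text \<open>Vertices are coloured in increasing order. Checking the edges with larger end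
  \<open>v\<close> suffices, since in an edge list the smaller end is already coloured.\<close>

fun colourings :: "nat \<Rightarrow> (nat \<times> nat) list \<Rightarrow> nat \<Rightarrow> nat list list" where
  "colourings q es 0 = [[]]"
| "colourings q es (Suc v) =
     concat (map (\<lambda>c. map (\<lambda>x. c @ [x])
       (filter (\<lambda>x. list_all (\<lambda>(i, j). j = v \<longrightarrow> c ! i \<noteq> x) es) [0..<q]))
       (colourings q es v))"

definition label_count :: "nat \<Rightarrow> (nat \<times> nat) list \<Rightarrow> nat list \<Rightarrow> nat" where
  "label_count n es L = length (remdups (map (label_sum es L) [0..<n]))"

definition optimal_list :: "nat \<Rightarrow> (nat \<times> nat) list \<Rightarrow> nat list \<Rightarrow> bool" where
  "optimal_list n es L \<longleftrightarrow>
     antimagic_list es L \<and> colourings (label_count n es L - 1) es n = []"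

lemma simple_list_graph: "edge_list n es \<Longrightarrow> simple_graph {..<n} (list_graph es)"
  by (auto simp: edge_list_def list_graph_def simple_graph_def)

lemma antimagic_list_labeling:
  assumes es: "edge_list n es" and L: "antimagic_list es L"
  obtains f where "local_antimagic_labeling (list_graph es) f"
    and "vertex_sum (list_graph es) f = label_sum es L"
proof -
  let ?q = "length es"
  define P where "P = (\<lambda>k. case es ! k of (i, j) \<Rightarrow> {i, j})"
  have len: "length L = ?q" using L by (simp add: antimagic_list_def)
  have "bij_betw ((!) es) {..<?q} (set es)"
    using es by (intro bij_betw_nth) (auto simp: edge_list_def)
  moreover have "bij_betw (\<lambda>(i, j). {i, j}) (set es) (list_graph es)"
    unfolding bij_betw_def list_graph_def
  proof (intro conjI refl inj_onI, clarify)
    fix i j i' j' assume "(i, j) \<in> set es" "(i', j') \<in> set es" "{i, j} = {i', j'}"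
    moreover from this es have "i < j" "i' < j'" by (auto simp: edge_list_def)
    ultimately show "i = i' \<and> j = j'" by (auto simp: doubleton_eq_iff)
  qed
  ultimately have P: "bij_betw P {..<?q} (list_graph es)"
    using bij_betw_trans by (fastforce simp: P_def comp_def)
  \<comment> \<open>Distinct labels in the right range, as many as there are edges, must exhaust
    \<open>{1..?q}\<close>.\<close>
  have "set L \<subseteq> {1..?q}" using L by (auto simp: antimagic_list_def list_all_iff)
  moreover have "card (set L) = ?q" using L by (simp add: antimagic_list_def distinct_card)
  ultimately have "set L = {1..?q}" by (intro card_subset_eq) auto
  then have bijL: "bij_betw ((!) L) {..<?q} {1..?q}"
    using L by (intro bij_betw_nth) (auto simp: antimagic_list_def)
  \<comment> \<open>\<open>P\<close> sends a position to its edge, so \<open>f\<close> reads off the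
    label at the position of an edge in \<open>es\<close>.\<close>
  define f where "f = (!) L \<circ> inv_into {..<?q} P"
  have f: "bij_betw f (list_graph es) {1..?q}"
    unfolding f_def using bij_betw_trans[OF bij_betw_inv_into[OF P] bijL] .
  have fP: "f (P k) = L ! k" if "k < ?q" for k
    using that P by (simp add: f_def bij_betw_def inv_into_f_f)
  have sum: "vertex_sum (list_graph es) f v = label_sum es L v" for v
  proof -
    have fin: "finite (list_graph es)" by (simp add: list_graph_def)
    have mem: "v \<in> P k \<longleftrightarrow> (case es ! k of (i, j) \<Rightarrow> v = i \<or> v = j)" for k
      by (auto simp: P_def split: prod.split)
    \<comment> \<open>Zeros for the non-incident edges allow reindexing by positions, which then
      matches the filtered zip in \<open>label_sum\<close>.\<close>
    have "vertex_sum (list_graph es) f v = (\<Sum>e\<in>list_graph es. if v \<in> e then f e else 0)"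
      using fin unfolding vertex_sum_def incident_edges_def
      by (subst sum.inter_filter[symmetric]) auto
    also have "\<dots> = (\<Sum>k<?q. if v \<in> P k then f (P k) else 0)"
      by (rule sum.reindex_bij_betw[OF P, symmetric])
    also have "\<dots> = (\<Sum>k<?q. if case es ! k of (i, j) \<Rightarrow> v = i \<or> v = j then L ! k else 0)"
      by (intro sum.cong) (auto simp: mem fP)
    also have "\<dots> = label_sum es L v"
      unfolding label_sum_def sum_list_map_filter'
      unfolding sum_list_sum_nth using len by (intro sum.cong) (auto split: prod.splits)
    finally show ?thesis .
  qed
  have "label_sum es L u \<noteq> label_sum es L v" if "{u, v} \<in> list_graph es" for u v
    using that L by (fastforce simp: list_graph_def antimagic_list_def list_all_iff doubleton_eq_iff)
  then have "local_antimagic_labeling (list_graph es) f"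
    using f bij_betw_same_card[OF P] by (simp add: local_antimagic_labeling_def sum)
  then show ?thesis using that sum by blast
qed

lemma card_label_sums:
  "card (label_sum es L ` {..<n}) = label_count n es L"
  by (simp add: label_count_def length_remdups_card_conv atLeast0LessThan)

text \<open>Completeness of the search, by induction on the coloured prefix; an empty result
  therefore excludes every proper colouring with values below \<open>q\<close>.\<close>

lemma map_in_colourings:
  assumes "edge_list n es" and "proper_colouring (list_graph es) c"
    and "\<And>v. v < n \<Longrightarrow> c v < q" and "v \<le> n"
  shows "map c [0..<v] \<in> set (colourings q es v)"
  using assms(4)
proof (induction v)
  case (Suc v)
  have "c i \<noteq> c j" if "(i, j) \<in> set es" for i j
    using that assms(2) by (force simp: proper_colouring_def list_graph_def)
  then have "list_all (\<lambda>(i, j). j = v \<longrightarrow> map c [0..<v] ! i \<noteq> c v) es"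
    using assms(1) by (fastforce simp: list_all_iff edge_list_def)
  then show ?case using Suc assms(3)[of v] by auto
qed simp

lemma chromatic_number_list_graph_gt:
  assumes "edge_list n es" and "colourings q es n = []"
  shows "q < chromatic_number {..<n} (list_graph es)"
proof (rule ccontr)
  obtain c where c: "proper_colouring (list_graph es) c"
    "chromatic_number {..<n} (list_graph es) = card (c ` {..<n})"
    using chromatic_number_attained[OF simple_list_graph[OF assms(1)]] .
  assume "\<not> ?thesis"
  then have "card (c ` {..<n}) \<le> card {..<q}" using c by simp
  \<comment> \<open>A colouring may use arbitrary naturals; \<open>g\<close> renames its at most
    \<open>q\<close> colours to values below \<open>q\<close>.\<close>
  then obtain g where g: "g ` c ` {..<n} \<subseteq> {..<q}" "inj_on g (c ` {..<n})"
    using card_le_inj[of "c ` {..<n}" "{..<q}"] by auto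
  have "proper_colouring (list_graph es) (g \<circ> c)"
    using c(1) g(2) simple_graph_edge[OF simple_list_graph[OF assms(1)]]
    unfolding proper_colouring_def inj_on_def comp_def by (metis imageI)
  then have "map (g \<circ> c) [0..<n] \<in> set (colourings q es n)"
    using g(1) by (intro map_in_colourings[OF assms(1)]) auto
  then show False using assms(2) by simp
qed

text \<open>For a labeling with k sums, k - 1 < \<open>chromatic_number\<close> \<le>
  \<open>local_antimagic_chromatic_number\<close> \<le> k, so both equal k.\<close>

lemma local_antimagic_eq_chromatic_of_optimal_list:
  assumes "edge_list n es" and "optimal_list n es L"
  shows "local_antimagic_chromatic_number {..<n} (list_graph es) =
    chromatic_number {..<n} (list_graph es)"
proof -
  obtain f where f: "local_antimagic_labeling (list_graph es) f"
    "vertex_sum (list_graph es) f = label_sum es L"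
    using antimagic_list_labeling assms by (metis optimal_list_def)
  have "local_antimagic_chromatic_number {..<n} (list_graph es) \<le> label_count n es L"
    using local_antimagic_chromatic_number_le[OF f(1), of "{..<n}"] f(2) by (simp add: card_label_sums)
  moreover have "label_count n es L - 1 < chromatic_number {..<n} (list_graph es)"
    using assms by (intro chromatic_number_list_graph_gt) (auto simp: optimal_list_def)
  ultimately show ?thesis
    using chromatic_number_le_local_antimagic[OF f(1), of "{..<n}"] by simp
qed

text \<open>The code describes the complement: its rows list the non-edges.\<close>

definition code_edges :: "nat \<Rightarrow> nat list list \<Rightarrow> (nat \<times> nat) list" where
  "code_edges n rows =
     filter (\<lambda>(i, j). i < j \<and> j \<notin> set (rows ! i)) (List.product [0..<n] [0..<n])"

lemma edge_list_code_edges: "edge_list n (code_edges n rows)"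
  by (auto simp: edge_list_def code_edges_def distinct_product)

lemma edge_code_graph_iff:
  "{u, v} \<in> list_graph (code_edges n rows) \<longleftrightarrow>
     u < v \<and> v < n \<and> v \<notin> set (rows ! u) \<or> v < u \<and> u < n \<and> u \<notin> set (rows ! v)"
proof -
  have "{u, v} \<in> list_graph es \<longleftrightarrow> (u, v) \<in> set es \<or> (v, u) \<in> set es" for es
    unfolding list_graph_def by (auto simp: doubleton_eq_iff image_iff split: prod.splits)
  then show ?thesis by (auto simp: code_edges_def)
qed

section \<open>Complete bipartite graphs\<close>

lemma simple_complete_bipartite:
  "simple_graph (complete_bipartite_verts m n) (complete_bipartite_edges m n)"
  by (auto simp: simple_graph_def complete_bipartite_verts_def complete_bipartite_edges_def)

lemma vertex_sum_complete_bipartite: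
  shows "i < m \<Longrightarrow> vertex_sum (complete_bipartite_edges m n) f (Inl i) = (\<Sum>j<n. f {Inl i, Inr j})"
    and "j < n \<Longrightarrow> vertex_sum (complete_bipartite_edges m n) f (Inr j) = (\<Sum>i<m. f {Inl i, Inr j})"
proof -
  assume "i < m"
  then have "incident_edges (complete_bipartite_edges m n) (Inl i) = (\<lambda>j. {Inl i, Inr j}) ` {..<n}"
    by (auto simp: incident_edges_def complete_bipartite_edges_def)
  then show "vertex_sum (complete_bipartite_edges m n) f (Inl i) = (\<Sum>j<n. f {Inl i, Inr j})"
    by (simp add: vertex_sum_def sum.reindex inj_on_def doubleton_eq_iff)
next
  assume "j < n"
  then have "incident_edges (complete_bipartite_edges m n) (Inr j) = (\<lambda>i. {Inl i, Inr j}) ` {..<m}"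
    by (auto simp: incident_edges_def complete_bipartite_edges_def)
  then show "vertex_sum (complete_bipartite_edges m n) f (Inr j) = (\<Sum>i<m. f {Inl i, Inr j})"
    by (simp add: vertex_sum_def sum.reindex inj_on_def doubleton_eq_iff)
qed

lemma chromatic_number_complete_bipartite:
  assumes "0 < m" "0 < n"
  shows "chromatic_number (complete_bipartite_verts m n) (complete_bipartite_edges m n) = 2"
proof -
  let ?V = "complete_bipartite_verts m n" and ?E = "complete_bipartite_edges m n"
  let ?c = "case_sum (\<lambda>_. 0) (\<lambda>_. 1) :: nat + nat \<Rightarrow> nat"
  have "proper_colouring ?E ?c"
    by (auto simp: proper_colouring_def complete_bipartite_edges_def doubleton_eq_iff)
  then have "chromatic_number ?V ?E \<le> card (?c ` ?V)" by (rule chromatic_number_le)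
  also have "\<dots> \<le> card {0, 1 :: nat}"
    by (intro card_mono) (auto simp: complete_bipartite_verts_def)
  finally have "chromatic_number ?V ?E \<le> 2" by simp
  moreover obtain c where c: "proper_colouring ?E c" "chromatic_number ?V ?E = card (c ` ?V)"
    using chromatic_number_attained[OF simple_complete_bipartite] .
  have "{Inl 0, Inr 0} \<in> ?E" using assms by (auto simp: complete_bipartite_edges_def)
  then have "card {c (Inl 0), c (Inr 0)} = 2"
    using c(1) unfolding proper_colouring_def by (metis card_2_iff)
  moreover have "card {c (Inl 0), c (Inr 0)} \<le> card (c ` ?V)"
    using assms by (intro card_mono) (auto simp: complete_bipartite_verts_def)
  ultimately show ?thesis using c(2) by simp
qed

text \<open>With two values each side is monochromatic; as the sums over either side add up to the sum
  of all labels and the sides have equal size, the two values would coincide.\<close>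

lemma card_vertex_sum_complete_bipartite_gt_2:
  assumes "0 < n" and f: "local_antimagic_labeling (complete_bipartite_edges n n) f"
  shows "2 < card (vertex_sum (complete_bipartite_edges n n) f ` complete_bipartite_verts n n)"
proof (rule ccontr)
  define s where "s = vertex_sum (complete_bipartite_edges n n) f"
  let ?A = "(\<lambda>i. s (Inl i)) ` {..<n}" and ?B = "(\<lambda>j. s (Inr j)) ` {..<n}"
  assume "\<not> ?thesis"
  moreover have "s ` complete_bipartite_verts n n = ?A \<union> ?B"
    by (auto simp: complete_bipartite_verts_def)
  ultimately have "card (?A \<union> ?B) \<le> 2" by (simp add: s_def)
  moreover have "s (Inl i) \<noteq> s (Inr j)" if "i < n" "j < n" for i j
    using f that by (auto simp: local_antimagic_labeling_def s_def complete_bipartite_edges_def)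
  then have "?A \<inter> ?B = {}" by auto
  then have "card (?A \<union> ?B) = card ?A + card ?B" by (intro card_Un_disjoint) auto
  moreover have "0 < card ?A" "0 < card ?B" using \<open>0 < n\<close> by (auto simp: card_gt_0_iff)
  ultimately have "card ?A = 1" "card ?B = 1" by linarith+
  then obtain a b where ab: "?A = {a}" "?B = {b}" by (auto simp: card_1_singleton_iff)
  have "s (Inl i) = a" "s (Inr i) = b" if "i < n" for i
    using ab that by (metis imageI lessThan_iff singletonD)+
  then have b: "(\<Sum>j<n. s (Inr j)) = n * b" and "n * a = (\<Sum>i<n. s (Inl i))" by simp_all
  note this(2)
  also have "\<dots> = (\<Sum>i<n. \<Sum>j<n. f {Inl i, Inr j})"
    by (intro sum.cong) (auto simp: s_def vertex_sum_complete_bipartite)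
  also have "\<dots> = (\<Sum>j<n. \<Sum>i<n. f {Inl i, Inr j})" by (rule sum.swap)
  also have "\<dots> = (\<Sum>j<n. s (Inr j))"
    by (intro sum.cong) (auto simp: s_def vertex_sum_complete_bipartite)
  also have "\<dots> = n * b" by (fact b)
  finally have "a = b" using \<open>0 < n\<close> by simp
  then show False using ab \<open>?A \<inter> ?B = {}\<close> by simp
qed

section \<open>The exceptional graph K_{4,4}\<close>

text \<open>The complement of K_{4,4} consists of two disjoint copies of K_4, here on 0 to 3 and on
  4 to 7.\<close>

definition K44_code :: "nat list list" where
  "K44_code = [[1,2,3],[2,3],[3],[],[5,6,7],[6,7],[7],[]]"

lemma K44_code_iff:
  assumes "i < j" "j < 8"
  shows "j \<notin> set (K44_code ! i) \<longleftrightarrow> i < 4 \<and> 4 \<le> j"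
proof -
  have "\<forall>i\<in>set [0..<8]. \<forall>j\<in>set [0..<8]. i < j \<longrightarrow> (j \<notin> set (K44_code ! i) \<longleftrightarrow> i < 4 \<and> 4 \<le> j)"
    by code_simp
  then show ?thesis using assms by simp
qed

lemma K44_code_isomorphic:
  "graph_isomorphic {..<8} (list_graph (code_edges 8 K44_code))
     (complete_bipartite_verts 4 4) (complete_bipartite_edges 4 4)"
proof -
  define \<phi> :: "nat \<Rightarrow> nat + nat" where "\<phi> = (\<lambda>i. if i < 4 then Inl i else Inr (i - 4))"
  have "bij_betw \<phi> {..<8} (complete_bipartite_verts 4 4)"
    by (rule bij_betw_byWitness[where f' = "case_sum id (\<lambda>j. j + 4)"])
       (auto simp: \<phi>_def complete_bipartite_verts_def)
  moreover have "{u, v} \<in> list_graph (code_edges 8 K44_code) \<longleftrightarrow>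
      {\<phi> u, \<phi> v} \<in> complete_bipartite_edges 4 4" if "u < 8" "v < 8" for u v
  proof -
    have "{u, v} \<in> list_graph (code_edges 8 K44_code) \<longleftrightarrow> u < 4 \<and> 4 \<le> v \<or> v < 4 \<and> 4 \<le> u"
      using that K44_code_iff[of u v] K44_code_iff[of v u] by (auto simp: edge_code_graph_iff)
    also have "\<dots> \<longleftrightarrow> {\<phi> u, \<phi> v} \<in> complete_bipartite_edges 4 4"
      using that by (auto simp: \<phi>_def complete_bipartite_edges_def doubleton_eq_iff)
    finally show ?thesis .
  qed
  ultimately show ?thesis unfolding graph_isomorphic_def by auto
qed

text \<open>Read row by row as a 4 by 4 matrix, this is nearly a magic square: all row sums are 34,
  and the column sums are 28, 36, 36, 36, which gives three values.\<close>

definition K44_labels :: "nat list" where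
  "K44_labels = [13,6,11,4,9,8,15,2,1,10,7,16,5,12,3,14]"

lemma antimagic_K44_labels:
  "antimagic_list (code_edges 8 K44_code) K44_labels \<and>
   label_count 8 (code_edges 8 K44_code) K44_labels = 3"
  by code_simp

text \<open>The upper bound comes from \<open>K44_labels\<close> on the numbered copy, the lower
  bound from double counting on the two-sided model.\<close>

lemma local_antimagic_chromatic_number_K44:
  "local_antimagic_chromatic_number (complete_bipartite_verts 4 4) (complete_bipartite_edges 4 4) = 3"
proof -
  let ?W = "complete_bipartite_verts 4 4" and ?F = "complete_bipartite_edges 4 4"
  let ?E = "list_graph (code_edges 8 K44_code)"
  have eq: "local_antimagic_chromatic_number {..<8} ?E = local_antimagic_chromatic_number ?W ?F"
    using simple_list_graph[OF edge_list_code_edges] simple_complete_bipartite K44_code_isomorphic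
    by (rule local_antimagic_chromatic_number_isomorphic)
  obtain f where f: "local_antimagic_labeling ?E f"
    "vertex_sum ?E f = label_sum (code_edges 8 K44_code) K44_labels"
    using antimagic_list_labeling[OF edge_list_code_edges] antimagic_K44_labels by metis
  have "local_antimagic_chromatic_number ?W ?F \<le> 3"
    using local_antimagic_chromatic_number_le[OF f(1), of "{..<8}"] antimagic_K44_labels
    by (simp add: eq f(2) card_label_sums)
  \<comment> \<open>The counts of the numbered copy are nonempty and contained in those of
    \<open>?F\<close>, so \<open>?F\<close> has a labeling and its infimum is not the default
    0.\<close>
  moreover have "\<exists>g. local_antimagic_labeling ?F g"
    using antimagic_counts_subset[OF simple_complete_bipartite
        simple_list_graph[OF edge_list_code_edges] graph_isomorphic_sym[OF K44_code_isomorphic]] f(1)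
    by blast
  then obtain g where "local_antimagic_labeling ?F g"
    "local_antimagic_chromatic_number ?W ?F = card (vertex_sum ?F g ` ?W)"
    using local_antimagic_chromatic_number_attained by metis
  then have "2 < local_antimagic_chromatic_number ?W ?F"
    using card_vertex_sum_complete_bipartite_gt_2[of 4 g] by simp
  ultimately show ?thesis by simp
qed

section \<open>Quartic graphs of order at most eight\<close>

text \<open>The map \<open>w \<mapsto> {v, w}\<close> identifies neighbours with incident edges;
  deleting these \<open>k\<close> neighbours and \<open>v\<close> itself leaves the vertices
  adjacent to \<open>v\<close> in the complement.\<close>

lemma card_non_neighbours:
  assumes "regular_graph k V E" and "v \<in> V"
  shows "card {w \<in> V. v \<noteq> w \<and> {v, w} \<notin> E} = card V - Suc k"
proof -
  have simple: "simple_graph V E" and deg: "card (incident_edges E v) = k"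
    using assms by (auto simp: regular_graph_def)
  define N where "N = {w \<in> V. {v, w} \<in> E}"
  have fin: "finite V" using simple by (simp add: simple_graph_def)
  have "bij_betw (\<lambda>w. {v, w}) N (incident_edges E v)"
    unfolding bij_betw_def
  proof
    show "inj_on (\<lambda>w. {v, w}) N" by (auto simp: inj_on_def doubleton_eq_iff)
    show "(\<lambda>w. {v, w}) ` N = incident_edges E v"
    proof
      show "incident_edges E v \<subseteq> (\<lambda>w. {v, w}) ` N"
      proof
        fix e assume "e \<in> incident_edges E v"
        then have e: "e \<in> E" "v \<in> e" by (auto simp: incident_edges_def)
        obtain a b where "e = {a, b}" using simple e(1) by (auto simp: simple_graph_def card_2_iff)
        then obtain w where "e = {v, w}" using e(2) by blast
        then show "e \<in> (\<lambda>w. {v, w}) ` N"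
          using e simple_graph_edge[OF simple] by (auto simp: N_def)
      qed
    qed (auto simp: N_def incident_edges_def)
  qed
  then have "card N = k" using deg by (simp add: bij_betw_same_card)
  moreover have "v \<notin> N" using simple_graph_edge(3)[OF simple, of v v] by (auto simp: N_def)
  moreover have "finite N" using fin by (simp add: N_def)
  ultimately have "card (insert v N) = Suc k" by simp
  moreover have "{w \<in> V. v \<noteq> w \<and> {v, w} \<notin> E} = V - insert v N" by (auto simp: N_def)
  moreover have "insert v N \<subseteq> V" using assms(2) by (auto simp: N_def)
  ultimately show ?thesis
    using fin \<open>finite N\<close> card_Diff_subset[of "insert v N" V] by simp
qed

text \<open>The complement is enumerated because of its low degree: at most 3 for quartic graphs of
  order at most 8, which keeps the search small.\<close>

lemma regular_graph_code:
  assumes "regular_graph k V E"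
  obtains rows where "rows \<in> set (codes (card V) (card V - Suc k))"
    and "graph_isomorphic {..<card V} (list_graph (code_edges (card V) rows)) V E"
proof -
  have simple: "simple_graph V E" using assms by (simp add: regular_graph_def)
  define R where "R = (\<lambda>u v. u \<noteq> v \<and> {u, v} \<notin> E)"
  have fin: "finite V" using simple by (simp add: simple_graph_def)
  have sym: "R v u" if "R u v" for u v using that by (auto simp: R_def insert_commute)
  have irr: "\<not> R v v" for v by (simp add: R_def)
  have reg: "card {w \<in> V. R v w} = card V - Suc k" if "v \<in> V" for v
    using card_non_neighbours[OF assms that] by (simp add: R_def)
  obtain rows \<phi> where rows: "rows \<in> set (codes (card V) (card V - Suc k))"
    and bij: "bij_betw \<phi> {..<card V} V"
    and adj: "\<forall>i j. i < j \<longrightarrow> j < card V \<longrightarrow> R (\<phi> i) (\<phi> j) = (j \<in> set (rows ! i))"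
    using ex_code[of V R, OF fin sym irr reg] by blast
  have edge: "{\<phi> i, \<phi> j} \<in> E \<longleftrightarrow> j \<notin> set (rows ! i)" if "i < j" "j < card V" for i j
  proof -
    have "\<phi> i \<noteq> \<phi> j" using bij that by (auto simp: bij_betw_def inj_on_def)
    then show ?thesis using adj that by (auto simp: R_def)
  qed
  have "{u, v} \<in> list_graph (code_edges (card V) rows) \<longleftrightarrow> {\<phi> u, \<phi> v} \<in> E"
    if "u < card V" "v < card V" for u v
    unfolding edge_code_graph_iff
    using that edge[of u v] edge[of v u] simple_graph_edge(3)[OF simple, of "\<phi> u" "\<phi> v"]
    by (cases u v rule: linorder_cases) (auto simp: insert_commute)
  then have "graph_isomorphic {..<card V} (list_graph (code_edges (card V) rows)) V E"
    using bij unfolding graph_isomorphic_def by auto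
  then show ?thesis using that rows by blast
qed

text \<open>
  The labelings were found by simulated annealing. The \<open>i\<close>-th list labels the edges, in lexicographic
  order, of the graph of the \<open>i\<close>-th code; the empty list belongs to \<open>K\<^sub>4\<^sub>,\<^sub>4\<close>.
\<close>

definition labels5 :: "nat list list" where
  "labels5 =
   [[5,8,3,9,6,4,1,7,2,10]]"

definition labels6 :: "nat list list" where
  "labels6 =
   [[6,10,3,2,1,7,8,5,12,11,4,9]]"

definition labels7 :: "nat list list" where
  "labels7 =
   [[12,4,1,9,6,10,7,3,8,11,5,2,13,14],
    [13,12,6,8,14,4,10,11,1,7,5,9,3,2],
    [11,8,6,9,12,3,14,5,2,7,4,13,10,1]]"

definition labels8 :: "nat list list" where
  "labels8 =
   [[],
    [7,16,8,4,6,12,14,3,10,11,5,9,15,2,13,1],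
    [7,16,8,4,10,11,5,9,6,12,14,3,15,2,13,1],
    [10,5,9,11,7,8,4,16,6,14,3,12,15,1,2,13],
    [5,9,6,10,8,1,14,7,2,13,12,3,11,16,15,4],
    [9,5,6,10,2,13,12,3,8,1,14,7,11,16,15,4],
    [2,13,12,3,9,5,6,10,1,8,14,7,11,15,16,4],
    [2,13,3,12,9,5,10,6,1,8,7,14,11,15,16,4],
    [4,10,7,12,14,6,3,15,5,9,16,8,13,1,11,2],
    [7,16,8,4,10,11,5,9,15,2,13,6,12,14,3,1],
    [5,6,9,10,8,14,1,7,2,11,16,13,12,3,4,15],
    [10,5,9,11,7,8,4,16,6,15,1,14,3,12,2,13],
    [9,5,6,10,2,13,12,3,8,11,16,1,14,7,15,4],
    [9,6,5,10,2,12,13,3,8,11,16,1,14,7,15,4],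
    [4,7,12,10,14,3,15,6,5,13,1,9,16,8,11,2],
    [2,12,3,13,9,6,10,5,1,11,15,8,14,7,16,4],
    [2,3,12,13,9,10,6,5,1,11,15,8,7,14,16,4],
    [5,6,9,10,8,2,11,16,14,1,7,13,12,3,4,15],
    [6,5,9,10,8,2,11,16,14,1,7,12,13,3,4,15],
    [5,6,9,10,2,8,11,16,13,12,3,14,1,7,4,15],
    [6,5,9,10,2,8,11,16,12,13,3,14,1,7,4,15],
    [5,9,10,11,7,6,15,1,8,4,16,14,3,12,2,13],
    [12,3,2,13,9,1,11,15,6,10,5,14,7,8,4,16],
    [3,12,2,13,9,1,11,15,10,6,5,7,14,8,16,4],
    [7,12,4,10,14,5,13,1,3,15,6,16,8,9,2,11],
    [13,1,14,5,2,7,3,16,12,15,8,4,10,11,9,6],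
    [13,1,5,14,2,7,16,3,12,8,15,4,10,11,9,6],
    [2,7,3,16,13,1,14,5,11,4,9,10,6,12,15,8],
    [6,14,13,2,16,4,3,12,11,8,5,7,10,1,15,9],
    [8,16,2,11,5,4,13,15,6,10,9,14,12,7,1,3],
    [11,2,4,12,6,15,14,3,5,7,10,8,1,13,9,16],
    [8,2,16,11,5,6,10,9,4,13,15,14,12,7,1,3],
    [11,4,2,12,6,5,7,10,15,14,3,8,1,9,13,16],
    [14,6,13,2,16,4,3,12,11,8,5,7,10,1,9,15],
    [2,11,4,12,6,15,14,3,5,7,10,8,1,13,16,9],
    [16,8,2,11,5,4,13,15,6,10,9,14,12,7,3,1],
    [7,2,3,16,13,1,14,5,11,4,9,10,6,12,15,8],
    [2,8,16,11,5,6,10,9,4,13,15,12,14,3,7,1],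
    [4,11,2,12,6,5,7,10,15,14,3,1,8,9,13,16],
    [13,1,14,5,7,2,3,16,12,4,10,15,8,11,9,6],
    [13,1,5,14,7,2,16,3,12,4,10,8,15,11,9,6],
    [8,2,16,11,6,5,10,9,4,14,12,13,15,7,1,3],
    [11,4,2,12,5,6,7,10,15,8,1,14,3,9,13,16],
    [8,2,11,16,6,5,9,10,4,14,12,13,15,1,7,3],
    [11,4,12,2,5,6,10,7,15,8,1,14,3,9,13,16],
    [2,8,16,11,6,5,10,9,4,12,14,13,15,3,7,1],
    [4,11,2,12,5,6,7,10,15,1,8,14,3,9,13,16],
    [2,8,11,16,6,5,9,10,4,12,14,13,15,3,1,7],
    [4,11,12,2,5,6,10,7,15,1,8,14,3,9,13,16],
    [14,5,13,1,7,12,4,10,2,3,16,15,8,6,9,11],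
    [14,5,1,13,7,12,10,4,2,3,16,15,8,6,9,11]]"

text \<open>The second argument of \<open>codes\<close> is the degree \<open>p - 5\<close> of the
  complement, here and in the next three checks. \<open>list_all2\<close> also forces equal lengths,
  so no generated code escapes the test.\<close>

lemma optimal_labels5: "list_all2 (\<lambda>rows. optimal_list 5 (code_edges 5 rows)) (codes 5 0) labels5"
  by code_simp

lemma optimal_labels6: "list_all2 (\<lambda>rows. optimal_list 6 (code_edges 6 rows)) (codes 6 1) labels6"
  by code_simp

lemma optimal_labels7: "list_all2 (\<lambda>rows. optimal_list 7 (code_edges 7 rows)) (codes 7 2) labels7"
  by code_simp

text \<open>The first code generated is that of K_{4,4}; it passes by the first disjunct, since none
  of its labelings has only two sums.\<close>

lemma optimal_labels8:
  "list_all2 (\<lambda>rows L. rows = K44_code \<or> optimal_list 8 (code_edges 8 rows) L) (codes 8 3) labels8"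
  by code_simp

lemma ex_optimal_list:
  assumes "n \<in> {5..8}" and "rows \<in> set (codes n (n - 5))"
  shows "n = 8 \<and> rows = K44_code \<or> (\<exists>L. optimal_list n (code_edges n rows) L)"
proof -
  have ex: "\<exists>L. P x L" if "list_all2 P xs ys" "x \<in> set xs"
    for P and x :: "nat list list" and xs and ys :: "nat list list"
    using that by (metis in_set_conv_nth list_all2_conv_all_nth)
  have "n = 5 \<or> n = 6 \<or> n = 7 \<or> n = 8" using assms(1) by auto
  then show ?thesis
    using assms(2) ex[OF optimal_labels5, of rows] ex[OF optimal_labels6, of rows]
      ex[OF optimal_labels7, of rows] ex[OF optimal_labels8, of rows]
    by (elim disjE) auto
qed

theorem theorem2p5:
  fixes V :: "'a set" and E :: "'a set set" and p :: nat
  assumes "regular_graph 4 V E"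
    and "card V = p"
    and "5 \<le> p" and "p \<le> 8"
  shows "(\<not> graph_isomorphic V E (complete_bipartite_verts 4 4) (complete_bipartite_edges 4 4)
            \<longrightarrow> local_antimagic_chromatic_number V E = chromatic_number V E) \<and>
         (graph_isomorphic V E (complete_bipartite_verts 4 4) (complete_bipartite_edges 4 4)
            \<longrightarrow> local_antimagic_chromatic_number V E = chromatic_number V E + 1)"
proof (intro conjI impI)
  let ?W = "complete_bipartite_verts 4 4" and ?F = "complete_bipartite_edges 4 4"
  have simple: "simple_graph V E" using assms(1) by (simp add: regular_graph_def)
  show "local_antimagic_chromatic_number V E = chromatic_number V E + 1"
    if "graph_isomorphic V E ?W ?F"
    using chromatic_number_isomorphic[OF simple simple_complete_bipartite that]
      local_antimagic_chromatic_number_isomorphic[OF simple simple_complete_bipartite that]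
    by (simp add: chromatic_number_complete_bipartite local_antimagic_chromatic_number_K44)
  assume not_K44: "\<not> graph_isomorphic V E ?W ?F"
  obtain rows where rows: "rows \<in> set (codes p (p - 5))"
    and iso: "graph_isomorphic {..<p} (list_graph (code_edges p rows)) V E"
    using regular_graph_code[OF assms(1)] assms(2) by auto
  \<comment> \<open>Otherwise composing with \<open>K44_code_isomorphic\<close> would make the graph
    isomorphic to K_{4,4}.\<close>
  have "\<not> (p = 8 \<and> rows = K44_code)"
  proof
    assume "p = 8 \<and> rows = K44_code"
    with iso obtain \<phi> \<psi>
      where \<phi>: "bij_betw \<phi> V {..<8}" "\<forall>u\<in>V. \<forall>v\<in>V. {u, v} \<in> E \<longleftrightarrow>
          {\<phi> u, \<phi> v} \<in> list_graph (code_edges 8 K44_code)"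
        and \<psi>: "bij_betw \<psi> {..<8} ?W" "\<forall>u\<in>{..<8}. \<forall>v\<in>{..<8}.
          {u, v} \<in> list_graph (code_edges 8 K44_code) \<longleftrightarrow> {\<psi> u, \<psi> v} \<in> ?F"
      using K44_code_isomorphic graph_isomorphic_sym[OF iso] unfolding graph_isomorphic_def by blast
    have "graph_isomorphic V E ?W ?F"
      unfolding graph_isomorphic_def
      using bij_betw_trans[OF \<phi>(1) \<psi>(1)] \<phi>(2) \<psi>(2) bij_betw_apply[OF \<phi>(1)]
      by (intro exI[of _ "\<psi> \<circ> \<phi>"]) simp
    then show False using not_K44 by blast
  qed
  then obtain L where "optimal_list p (code_edges p rows) L"
    using ex_optimal_list[OF _ rows] assms(3,4) by auto
  then have "local_antimagic_chromatic_number {..<p} (list_graph (code_edges p rows)) =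
      chromatic_number {..<p} (list_graph (code_edges p rows))"
    by (rule local_antimagic_eq_chromatic_of_optimal_list[OF edge_list_code_edges])
  then show "local_antimagic_chromatic_number V E = chromatic_number V E"
    using chromatic_number_isomorphic[OF _ simple iso]
      local_antimagic_chromatic_number_isomorphic[OF _ simple iso]
      simple_list_graph[OF edge_list_code_edges]
    by simp
qed

end
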